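(* Let $\langle p:=\psi\rangle\varphi$ be a clean formula of $\mathcal{L}_{\mathsf{MSL}}$. Then $\langle p:=\psi\rangle\varphi\leftrightarrow\varphi[\psi/p]$ is valid in $\mathsf{MSL}$, i.e. for every Kripke model $M$ and state $w$ of $M$, $M,w\vDash\langle p:=\psi\rangle\varphi$ if and only if $M,w\vDash\varphi[\psi/p]$.
   Context: Language and semantics. Let $\mathbf{P}$ be a countable set of propositional letters. $\mathcal{L}_{\mathsf{MSL}}$: $\varphi::=p\mid\neg\varphi\mid\varphi\land\varphi\mid\Diamond\varphi\mid\langle p:=\varphi\rangle\varphi$, $p\in\mathbf{P}$. A (Kripke) model is $M=(W,R,V)$ with $W\neq\emptyset$, $R\subseteq W\times W$, $V:\mathbf{P}\to 2^W$. Truth: $M,w\vDash p$ iff $w\in V(p)$; Boolean connectives as usual; $M,w\vDash\Diamond\varphi$ iff $M,v\vDash\varphi$ for some $v$ with $Rwv$; $M,w\vDash\langle p:=\psi\rangle\varphi$ iff $M|_{p:=\psi},w\vDash\varphi$, where $M|_{p:=\psi}=(W,R,V')$ with $V'(p)=\{v\in W: M,v\vDash\psi\}$ and $V'(q)=V(q)$ for $q\neq p$. Free and bound variables. In $\langle p:=\psi\rangle\varphi$, $p$ is the pivot and $\varphi$ the scope of the operator $\langle p:=\psi\rangle$. An occurrence of a letter $p$ in a formula is bound if it is a pivot or lies in the scope of a substitution operator with pivot $p$; otherwise it is free. $bv(\varphi)$ (resp. $fv(\varphi)$) is the set of letters having a bound (resp. free) occurrence in $\varphi$. A formula $\varphi$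 is clean if $fv(\varphi)\cap bv(\varphi)=\emptyset$; by convention, calling a formula clean also means that all its subformulas satisfy this condition (the subformulas of $\langle p:=\psi\rangle\varphi$ are itself together with those of $\psi$ and of $\varphi$). Replacement. $\varphi[\psi/p]$ is defined by: $p[\psi/p]=\psi$; $q[\psi/p]=q$ for $q\neq p$; $(\neg\varphi)[\psi/p]=\neg(\varphi[\psi/p])$; $(\varphi_1\land\varphi_2)[\psi/p]=\varphi_1[\psi/p]\land\varphi_2[\psi/p]$; $(\Diamond\varphi)[\psi/p]=\Diamond(\varphi[\psi/p])$; $(\langle q:=\chi\rangle\varphi)[\psi/p]=\langle q:=\chi[\psi/p]\rangle(\varphi[\psi/p])$ if $q\neq p$, and $(\langle p:=\chi\rangle\varphi)[\psi/p]=\langle p:=\chi[\psi/p]\rangle\varphi$. *)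

theory Defs
  imports Main "HOL-Library.Countable"
begin

text \<open>
  The type variable \<open>'p\<close> stands for the set of propositional letters; it is constrained to the
  class \<open>countable\<close> (finite or countably infinite) where formulas are used as
  \<open>'p::countable msl\<close>.  \<open>Subst p \<psi> \<phi>\<close> is \<open>\<langle>p := \<psi>\<rangle>\<phi>\<close>, with pivot \<open>p\<close> and scope \<open>\<phi>\<close>
  (so \<open>\<psi>\<close> is not in the scope).
\<close>

datatype 'p msl =
    Atom 'p
  | Neg "'p msl"
  | Conj "'p msl" "'p msl"
  | Dia "'p msl"
  | Subst 'p "'p msl" "'p msl"

record ('w, 'p) kripke =
  worlds :: "'w set"
  rel :: "('w \<times> 'w) set"
  val :: "'p \<Rightarrow> 'w set"

definition kripke_model :: "('w, 'p) kripke \<Rightarrow> bool" where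
  "kripke_model M \<longleftrightarrow>
     worlds M \<noteq> {} \<and> rel M \<subseteq> worlds M \<times> worlds M \<and> (\<forall>p. val M p \<subseteq> worlds M)"

definition update :: "('w, 'p) kripke \<Rightarrow> 'p \<Rightarrow> 'w set \<Rightarrow> ('w, 'p) kripke" where
  "update M p X = M\<lparr>val := (val M)(p := X)\<rparr>"

primrec sat :: "('w, 'p) kripke \<Rightarrow> 'w \<Rightarrow> 'p msl \<Rightarrow> bool" where
  "sat M w (Atom p) \<longleftrightarrow> w \<in> val M p"
| "sat M w (Neg \<phi>) \<longleftrightarrow> \<not> sat M w \<phi>"
| "sat M w (Conj \<phi> \<psi>) \<longleftrightarrow> sat M w \<phi> \<and> sat M w \<psi>"
| "sat M w (Dia \<phi>) \<longleftrightarrow> (\<exists>v. (w, v) \<in> rel M \<and> sat M v \<phi>)"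
| "sat M w (Subst p \<psi> \<phi>) \<longleftrightarrow> sat (update M p {v \<in> worlds M. sat M v \<psi>}) w \<phi>"

text \<open>
  \<open>(q, b, S) \<in> occs \<phi>\<close> means: some occurrence of the letter \<open>q\<close> in \<open>\<phi>\<close> is a pivot iff \<open>b\<close>, and
  \<open>S\<close> is the set of pivots of the substitution operators in \<open>\<phi>\<close> in whose scope it lies.
\<close>

primrec occs :: "'p msl \<Rightarrow> ('p \<times> bool \<times> 'p set) set" where
  "occs (Atom p) = {(p, False, {})}"
| "occs (Neg \<phi>) = occs \<phi>"
| "occs (Conj \<phi> \<psi>) = occs \<phi> \<union> occs \<psi>"
| "occs (Dia \<phi>) = occs \<phi>"
| "occs (Subst p \<psi> \<phi>) =
     {(p, True, {})} \<union> occs \<psi> \<union> {(q, b, insert p S) | q b S. (q, b, S) \<in> occs \<phi>}"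

definition bv :: "'p msl \<Rightarrow> 'p set" where
  "bv \<phi> = {q. \<exists>b S. (q, b, S) \<in> occs \<phi> \<and> (b \<or> q \<in> S)}"

definition fv :: "'p msl \<Rightarrow> 'p set" where
  "fv \<phi> = {q. \<exists>b S. (q, b, S) \<in> occs \<phi> \<and> \<not> (b \<or> q \<in> S)}"

lemma bv_simps [simp]:
  "bv (Atom p) = {}"
  "bv (Neg \<phi>) = bv \<phi>"
  "bv (Conj \<phi> \<psi>) = bv \<phi> \<union> bv \<psi>"
  "bv (Dia \<phi>) = bv \<phi>"
  "bv (Subst p \<psi> \<phi>) = {p} \<union> bv \<psi> \<union> bv \<phi>"
  by (auto simp: bv_def)

lemma fv_simps [simp]:
  "fv (Atom p) = {p}"
  "fv (Neg \<phi>) = fv \<phi>"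
  "fv (Conj \<phi> \<psi>) = fv \<phi> \<union> fv \<psi>"
  "fv (Dia \<phi>) = fv \<phi>"
  "fv (Subst p \<psi> \<phi>) = fv \<psi> \<union> (fv \<phi> - {p})"
  by (auto simp: fv_def)

primrec subformulas :: "'p msl \<Rightarrow> 'p msl set" where
  "subformulas (Atom p) = {Atom p}"
| "subformulas (Neg \<phi>) = insert (Neg \<phi>) (subformulas \<phi>)"
| "subformulas (Conj \<phi> \<psi>) = insert (Conj \<phi> \<psi>) (subformulas \<phi> \<union> subformulas \<psi>)"
| "subformulas (Dia \<phi>) = insert (Dia \<phi>) (subformulas \<phi>)"
| "subformulas (Subst p \<psi> \<phi>) = insert (Subst p \<psi> \<phi>) (subformulas \<psi> \<union> subformulas \<phi>)"

definition clean :: "'p msl \<Rightarrow> bool" where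
  "clean \<phi> \<longleftrightarrow> (\<forall>\<chi> \<in> subformulas \<phi>. fv \<chi> \<inter> bv \<chi> = {})"

text \<open>
  \<open>replace \<phi> \<psi> p\<close> is \<open>\<phi>[\<psi>/p]\<close>; it may capture free letters of \<open>\<psi>\<close>.
\<close>

primrec replace :: "'p msl \<Rightarrow> 'p msl \<Rightarrow> 'p \<Rightarrow> 'p msl" where
  "replace (Atom q) \<psi> p = (if q = p then \<psi> else Atom q)"
| "replace (Neg \<phi>) \<psi> p = Neg (replace \<phi> \<psi> p)"
| "replace (Conj \<phi>1 \<phi>2) \<psi> p = Conj (replace \<phi>1 \<psi> p) (replace \<phi>2 \<psi> p)"
| "replace (Dia \<phi>) \<psi> p = Dia (replace \<phi> \<psi> p)"
| "replace (Subst q \<chi> \<phi>) \<psi> p =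
     Subst q (replace \<chi> \<psi> p) (if q = p then \<phi> else replace \<phi> \<psi> p)"

end

theory Submission imports Defs begin

text \<open>
  The operator \<open>\<langle>p := \<psi>\<rangle>\<close> makes \<open>p\<close> name the truth set of \<open>\<psi>\<close>, computed once in the model at hand;
  replacement instead recomputes that truth set wherever \<open>p\<close> stood. Between those two
  moments the accessibility relation never changes, and the valuation changes only at the pivots
  passed on the way, which are letters of \<open>bv \<phi>\<close>. Truth of \<open>\<psi>\<close> depends only on the letters in
  \<open>fv \<psi>\<close> (\<open>sat_cong_fv\<close>), and cleanness keeps \<open>fv \<psi>\<close> apart from \<open>bv \<phi>\<close>: so the recomputation gives
  the same set, and the two sides agree (\<open>sat_replace\<close>).
\<close>

lemma update_simps [simp]:
  "worlds (update M p X) = worlds M"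
  "rel (update M p X) = rel M"
  "val (update M p X) = (val M)(p := X)"
  by (simp_all add: update_def)

lemma update_twice: "update (update M p X) p Y = update M p Y"
  by (simp add: update_def)

lemma update_commute:
  "p \<noteq> q \<Longrightarrow> update (update M p X) q Y = update (update M q Y) p X"
  by (simp add: update_def fun_upd_twist)

text \<open>
  The two models are arbitrary rather than \<open>M\<close> and an update of \<open>M\<close>, because below a substitution
  operator both are updated, possibly at a letter on which they differed.
\<close>

lemma sat_cong_fv:
  assumes "worlds M = worlds N" and "rel M = rel N"
    and "\<And>q. q \<in> fv \<phi> \<Longrightarrow> val M q = val N q"
  shows "sat M w \<phi> \<longleftrightarrow> sat N w \<phi>"
  using assms
proof (induction \<phi> arbitrary: M N w)
  case (Atom q)
  then show ?case by simp
next
  case (Neg \<phi>)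
  have "sat M w \<phi> \<longleftrightarrow> sat N w \<phi>"
    by (rule Neg.IH) (simp_all add: Neg.prems)
  then show ?case by simp
next
  case (Conj \<phi>1 \<phi>2)
  have "sat M w \<phi>1 \<longleftrightarrow> sat N w \<phi>1"
    by (rule Conj.IH(1)) (simp_all add: Conj.prems)
  moreover have "sat M w \<phi>2 \<longleftrightarrow> sat N w \<phi>2"
    by (rule Conj.IH(2)) (simp_all add: Conj.prems)
  ultimately show ?case by simp
next
  case (Dia \<phi>)
  have "sat M v \<phi> \<longleftrightarrow> sat N v \<phi>" for v
    by (rule Dia.IH) (simp_all add: Dia.prems)
  then show ?case
    by (simp add: Dia.prems(2))
next
  case (Subst q \<chi> \<phi>)
  let ?X = "{v \<in> worlds M. sat M v \<chi>}" and ?Y = "{v \<in> worlds N. sat N v \<chi>}"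
  have "sat M v \<chi> \<longleftrightarrow> sat N v \<chi>" for v
    by (rule Subst.IH(1)) (simp_all add: Subst.prems)
  then have "?X = ?Y"
    by (simp add: Subst.prems(1))
  then have "sat (update M q ?X) w \<phi> \<longleftrightarrow> sat (update N q ?Y) w \<phi>"
    by (intro Subst.IH(2)) (simp_all add: Subst.prems)
  then show ?case by simp
qed

corollary sat_update_fresh:
  "q \<notin> fv \<psi> \<Longrightarrow> sat (update M q X) w \<psi> \<longleftrightarrow> sat M w \<psi>"
  by (rule sat_cong_fv) auto

text \<open>
  Replacement never enters the scope of an operator with pivot \<open>p\<close>, so \<open>p\<close> itself cannot capture
  a letter of an inserted \<open>\<psi>\<close>; this is why \<open>p\<close> is exempt from the disjointness condition. The
  model has to vary in the induction since each pivot passed changes it. Worlds must be closed under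
  accessibility because the truth sets written into valuations contain worlds only, while \<open>\<psi>\<close> is
  evaluated at whatever point is reached.
\<close>

lemma sat_replace:
  assumes "rel M \<subseteq> worlds M \<times> worlds M" and "w \<in> worlds M"
    and "fv \<psi> \<inter> bv \<phi> \<subseteq> {p}"
  shows "sat (update M p {v \<in> worlds M. sat M v \<psi>}) w \<phi> \<longleftrightarrow> sat M w (replace \<phi> \<psi> p)"
  using assms
proof (induction \<phi> arbitrary: M w)
  case (Atom q)
  then show ?case by simp
next
  case (Neg \<phi>)
  then show ?case by simp
next
  case (Conj \<phi>1 \<phi>2)
  have "fv \<psi> \<inter> bv \<phi>1 \<subseteq> {p}" "fv \<psi> \<inter> bv \<phi>2 \<subseteq> {p}"
    using Conj.prems(3) by auto
  then show ?case
    using Conj.IH Conj.prems by simp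
next
  case (Dia \<phi>)
  have "sat (update M p {v \<in> worlds M. sat M v \<psi>}) v \<phi> \<longleftrightarrow> sat M v (replace \<phi> \<psi> p)"
    if "(w, v) \<in> rel M" for v
    using that Dia.prems by (intro Dia.IH) auto
  then show ?case by auto
next
  case (Subst q \<chi> \<phi>)
  let ?X = "{v \<in> worlds M. sat M v \<psi>}"
  let ?Y = "{v \<in> worlds M. sat M v (replace \<chi> \<psi> p)}"
  have "sat (update M p ?X) v \<chi> \<longleftrightarrow> sat M v (replace \<chi> \<psi> p)" if "v \<in> worlds M" for v
    using that Subst.prems by (intro Subst.IH(1)) auto
  then have Y: "{v \<in> worlds M. sat (update M p ?X) v \<chi>} = ?Y"
    by auto
  show ?case
  proof (cases "q = p")
    case True
    \<comment> \<open>The inner operator overwrites the value that the outer one gave to \<open>p\<close>.\<close>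
    then show ?thesis
      using Y by (simp add: update_twice)
  next
    case False
    then have fresh: "q \<notin> fv \<psi>"
      using Subst.prems(3) by auto
    let ?N = "update M q ?Y"
    \<comment> \<open>This equation lets the induction hypothesis be applied to \<open>?N\<close>.\<close>
    have X: "{v \<in> worlds ?N. sat ?N v \<psi>} = ?X"
      using sat_update_fresh[OF fresh, of M ?Y] by simp
    have "sat (update M p ?X) w (Subst q \<chi> \<phi>) \<longleftrightarrow> sat (update (update M p ?X) q ?Y) w \<phi>"
      using Y by simp
    also have "\<dots> \<longleftrightarrow> sat (update ?N p ?X) w \<phi>"
      using False by (subst update_commute) auto
    also have "\<dots> \<longleftrightarrow> sat ?N w (replace \<phi> \<psi> p)"
    proof -
      have "sat (update ?N p {v \<in> worlds ?N. sat ?N v \<psi>}) w \<phi> \<longleftrightarrow> sat ?N w (replace \<phi> \<psi> p)"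
        by (rule Subst.IH(2)) (use Subst.prems in auto)
      then show ?thesis
        unfolding X .
    qed
    also have "\<dots> \<longleftrightarrow> sat M w (replace (Subst q \<chi> \<phi>) \<psi> p)"
      using False by simp
    finally show ?thesis .
  qed
qed

theorem theorem3p6:
  fixes p :: "'p::countable" and \<phi> \<psi> :: "'p msl"
    and M :: "('w, 'p) kripke" and w :: 'w
  assumes "clean (Subst p \<psi> \<phi>)"
    and "kripke_model M"
    and "w \<in> worlds M"
  shows "sat M w (Subst p \<psi> \<phi>) \<longleftrightarrow> sat M w (replace \<phi> \<psi> p)"
proof -
  have "fv (Subst p \<psi> \<phi>) \<inter> bv (Subst p \<psi> \<phi>) = {}"
    using assms(1) by (simp add: clean_def del: fv_simps bv_simps)
  then have "fv \<psi> \<inter> bv \<phi> \<subseteq> {p}"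
    by auto
  then show ?thesis
    using assms(2,3) by (simp add: sat_replace kripke_model_def)
qed

end
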